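(* \[ B^{(\mathrm{pk},\mathrm{des})}(x,y,t)=\exp\!\left(D^{t,x}\ln\!\left(1+\frac{(1+t)(1+u)v(w-1)}{yt(1+uv)(1-vw)}\right)\right), \] where \[ u=\frac{1+t^2-2yt-(1-t)\sqrt{(1+t)^2-4yt}}{2(1-y)t},\qquad v=\frac{(1+t)^2-2yt-(1+t)\sqrt{(1+t)^2-4yt}}{2yt}, \] and \[ w=\exp\!\left(\frac{x(1+u)(1-v)}{1+uv}\right). \]
   Context: For a permutation $\pi=\pi_1\cdots\pi_n$ of $[n]$, $\operatorname{des}(\pi)$ is the number of $1\le i\le n-1$ with $\pi_i>\pi_{i+1}$, $\operatorname{asc}(\pi)$ the number with $\pi_i<\pi_{i+1}$, and $\operatorname{pk}(\pi)$ the number of $2\le i\le n-1$ with $\pi_{i-1}<\pi_i>\pi_{i+1}$. A ballot permutation is one with $\operatorname{asc}(\pi_1\cdots\pi_i)\ge\operatorname{des}(\pi_1\cdots\pi_i)$ for all $i$; $\mathscr B_n$ is the set of ballot permutations of $[n]$, $\mathscr B_0=\{\epsilon\}$ (empty permutation, statistics $0$). $B^{(\mathrm{pk},\mathrm{des})}(x,y,t)=\sum_{n\ge0}\sum_{\pi\in\mathscr B_n} y^{\operatorname{pk}(\pi)}t^{\operatorname{des}(\pi)}\frac{x^n}{n!}$. For a multivariate formal power series $P=\sum p(n_1,\dots,n_k)x_1^{n_1}\cdots x_k^{n_k}$, the operator $D^{x_1,x_2}$ is defined by $D^{x_1,x_2}P=\sum_{n_1\le (n_2-1)/2}p(n_1,\dots,n_k)x_1^{n_1}\cdots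 x_k^{n_k}$, i.e. it keeps exactly the monomials in which the exponent of $x_1$ is at most (exponent of $x_2$ minus $1$)/2; here $D^{t,x}$ keeps monomials $x^n y^k t^d$ with $d\le (n-1)/2$. *)

theory Defs
  imports "HOL-Computational_Algebra.Formal_Power_Series"
          "HOL-Computational_Algebra.Formal_Laurent_Series"
begin

definition is_perm :: "nat \<Rightarrow> nat list \<Rightarrow> bool" where
  "is_perm n \<pi> \<longleftrightarrow> distinct \<pi> \<and> set \<pi> = {1..n}"

(* 0-based list indices: position i corresponds to pi_(i+1) *)
definition des :: "nat list \<Rightarrow> nat" where
  "des \<pi> = card {i. i + 1 < length \<pi> \<and> \<pi> ! i > \<pi> ! (i + 1)}"

definition asc :: "nat list \<Rightarrow> nat" where
  "asc \<pi> = card {i. i + 1 < length \<pi> \<and> \<pi> ! i < \<pi> ! (i + 1)}"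

definition pk :: "nat list \<Rightarrow> nat" where
  "pk \<pi> = card {i. 0 < i \<and> i + 1 < length \<pi> \<and> \<pi> ! (i - 1) < \<pi> ! i \<and> \<pi> ! i > \<pi> ! (i + 1)}"

definition is_ballot :: "nat list \<Rightarrow> bool" where
  "is_ballot \<pi> \<longleftrightarrow> (\<forall>i\<le>length \<pi>. asc (take i \<pi>) \<ge> des (take i \<pi>))"

definition ballot_perms :: "nat \<Rightarrow> nat list set" where
  "ballot_perms n = {\<pi>. is_perm n \<pi> \<and> is_ballot \<pi>}"

type_synonym coeff = "real fls fls"

definition tvar :: coeff where "tvar = fls_X"
definition yvar :: coeff where "yvar = fls_const fls_X"

section \<open>Square root of a power series with constant term 1 (principal branch)\<close>

definition fps_sqrt1 :: "'a::field_char_0 fps \<Rightarrow> 'a fps" where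
  "fps_sqrt1 f = fps_binomial (1/2) oo (f - 1)"

(* exp(G) and ln(1+G) for G with zero constant term *)
definition fexp :: "coeff fps \<Rightarrow> coeff fps" where
  "fexp G = fps_exp 1 oo G"
definition fln1p :: "coeff fps \<Rightarrow> coeff fps" where
  "fln1p G = fps_ln 1 oo G"

definition Dtx :: "coeff fps \<Rightarrow> coeff fps" where
  "Dtx P = Abs_fps (\<lambda>n. Abs_fls (\<lambda>d. if 2 * d + 1 \<le> int n then fls_nth (fps_nth P n) d else 0))"

definition B_pk_des :: "coeff fps" where
  "B_pk_des = Abs_fps (\<lambda>n. (\<Sum>\<pi>\<in>ballot_perms n. yvar ^ pk \<pi> * tvar ^ des \<pi>) / of_nat (fact n))"

definition sqrt_term :: coeff where
  "sqrt_term = fps_to_fls (fps_sqrt1 ((1 + fps_X)^2 - 4 * fps_const fls_X * fps_X))"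

definition u_ser :: coeff where
  "u_ser = (1 + tvar^2 - 2 * yvar * tvar - (1 - tvar) * sqrt_term) / (2 * (1 - yvar) * tvar)"

definition v_ser :: coeff where
  "v_ser = ((1 + tvar)^2 - 2 * yvar * tvar - (1 + tvar) * sqrt_term) / (2 * yvar * tvar)"

definition w_ser :: "coeff fps" where
  "w_ser = fps_exp ((1 + u_ser) * (1 - v_ser) / (1 + u_ser * v_ser))"

definition F_ser :: "coeff fps" where
  "F_ser = fps_const ((1 + tvar) * (1 + u_ser) * v_ser / (yvar * tvar * (1 + u_ser * v_ser)))
           * (w_ser - 1) / (1 - fps_const v_ser * w_ser)"

end

theory Submission
  imports Defs "HOL-Combinatorics.Multiset_Permutations"
begin

text \<open>
  Write \<open>A\<close> for the generating function of all nonempty permutations and \<open>C\<close> for that of the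
  permutations all of whose suffixes have at least as many descents as ascents, a nonempty one
  being weighted by an extra factor \<open>t\<close>. Then \<open>1 + (1 + t) A = C B\<close>: follow the walk of a
  nonempty permutation that goes up at ascents and down at descents; the cuts into an admissible
  prefix for \<open>C\<close> and a ballot suffix are exactly two, just before the first minimum and just after
  the last one, neither of them destroys a peak, and they contribute with weights \<open>1\<close> and \<open>t\<close>.
  Since \<open>ln B\<close> only has monomials with \<open>2d < n\<close> and \<open>ln C\<close> only those with \<open>2d \<ge> n\<close>, the operator
  \<open>D\<close> extracts \<open>ln B\<close> from \<open>ln (C B)\<close>. Removing the largest letter gives the Riccati equation
  \<open>A' = 1 + (1 + t) A + y t A\<^sup>2\<close>, which is solved by the closed form with \<open>u\<close>, \<open>v\<close>, \<open>w\<close>.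
\<close>

unbundle Formal_Power_Series.fps_syntax
unbundle Formal_Laurent_Series.fps_syntax

section \<open>Logarithms of series with restricted support\<close>

lemma fls_mult_nth_nonzeroE:
  fixes f g :: "'a::semiring_0 fls"
  assumes "(f * g) $$ n \<noteq> 0"
  obtains i j where "i + j = n" "f $$ i \<noteq> 0" "g $$ j \<noteq> 0"
proof -
  obtain i where "f $$ i * g $$ (n - i) \<noteq> 0"
    using assms unfolding fls_times_nth(2) by (meson sum.neutral)
  then show thesis
    by (intro that[of i "n - i"]) auto
qed

text \<open>\<open>n\<close> is the exponent of x and \<open>d\<close> that of t; powers of y stay
  inside the coefficients and are not tracked.\<close>

definition supported :: "(nat \<Rightarrow> int \<Rightarrow> bool) \<Rightarrow> 'a::zero fls fps \<Rightarrow> bool" where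
  "supported R P \<longleftrightarrow> (\<forall>n d. P $ n $$ d \<noteq> 0 \<longrightarrow> R n d)"

definition sum_closed :: "(nat \<Rightarrow> int \<Rightarrow> bool) \<Rightarrow> bool" where
  "sum_closed R \<longleftrightarrow> (\<forall>a b d e. R a d \<longrightarrow> R b e \<longrightarrow> R (a + b) (d + e))"

lemma fls_sum_nth: "(\<Sum>i\<in>A. f i) $$ d = (\<Sum>i\<in>A. f i $$ d)"
  by (induction A rule: infinite_finite_induct) auto

lemma supported_mult:
  fixes P Q :: "'a::ring_1 fls fps"
  assumes "sum_closed R" "supported R P" "supported R Q"
  shows "supported R (P * Q)"
  unfolding supported_def
proof (intro allI impI)
  fix n d assume "(P * Q) $ n $$ d \<noteq> 0"
  then obtain i where i: "i \<in> {0..n}" "(P $ i * Q $ (n - i)) $$ d \<noteq> 0"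
    unfolding fps_mult_nth fls_sum_nth by (meson sum.neutral)
  from i(2) obtain a b where "a + b = d" "P $ i $$ a \<noteq> 0" "Q $ (n - i) $$ b \<noteq> 0"
    by (rule fls_mult_nth_nonzeroE)
  then have "R (i + (n - i)) (a + b)"
    using assms unfolding supported_def sum_closed_def by blast
  then show "R n d"
    using i \<open>a + b = d\<close> by simp
qed

text \<open>\<open>k > 0\<close> matters: the monomial 1 has exponents (0, 0), which
  \<open>low\<close> rejects.\<close>

lemma supported_power:
  fixes P :: "'a::ring_1 fls fps"
  assumes "sum_closed R" "supported R P" "k > 0"
  shows "supported R (P ^ k)"
  using assms(3)
proof (induction k rule: nat_induct_non_zero)
  case (Suc k)
  then show ?case
    using supported_mult[OF assms(1,2)] by simp
qed (use assms in simp)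

lemma supported_fps_ln_compose:
  fixes G :: "'a::field_char_0 fls fps"
  assumes "sum_closed R" "supported R G"
  shows "supported R (fps_ln 1 oo G)"
  unfolding supported_def
proof (intro allI impI)
  fix n d assume "(fps_ln 1 oo G) $ n $$ d \<noteq> 0"
  then obtain i where i: "(fps_ln 1 $ i * (G ^ i $ n)) $$ d \<noteq> 0"
    unfolding fps_compose_nth fls_sum_nth by (meson sum.neutral)
  then have "i > 0"
    by (cases "i = 0") auto
  \<comment> \<open>The coefficients of the logarithm are constant in t, so multiplying by them does
    not move the exponent \<open>d\<close>.\<close>
  have "(- 1) ^ k = fls_const ((- 1 :: 'a) ^ k)" for k
    by (cases "even k") simp_all
  then have "fps_ln (1 :: 'a fls) $ i = fls_const ((- 1) ^ (i - 1) / of_nat i)"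
    using \<open>i > 0\<close> by (simp add: fps_ln_nth fls_of_nat fls_const_divide_const)
  with i have "G ^ i $ n $$ d \<noteq> 0"
    by auto
  then show "R n d"
    using supported_power[OF assms \<open>i > 0\<close>] unfolding supported_def by blast
qed

section \<open>Formal logarithm and exponential\<close>

lemma fps_deriv_ln_compose:
  fixes G :: "'a::field_char_0 fps"
  assumes "G $ 0 = 0"
  shows "fps_deriv (fps_ln 1 oo G) = inverse (1 + G) * fps_deriv G"
  using assms
  by (simp add: fps_compose_deriv fps_ln_deriv fps_inverse_compose fps_compose_add_distrib)

text \<open>The logarithmic derivative turns the product into a sum, and both sides have zero
  constant term.\<close>

lemma fps_ln_compose_mult:
  fixes F G H :: "'a::field_char_0 fps"
  assumes "1 + F = (1 + G) * (1 + H)" "G $ 0 = 0" "H $ 0 = 0"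
  shows "fps_ln 1 oo F = (fps_ln 1 oo G) + (fps_ln 1 oo H)"
proof -
  have F: "F = (1 + G) * (1 + H) - 1"
    using assms(1) by (simp add: algebra_simps)
  have F0: "F $ 0 = 0"
    unfolding F by (simp add: assms)
  have inv: "inverse (1 + G) * (1 + G) = 1" "inverse (1 + H) * (1 + H) = 1"
    using assms by (auto intro: inverse_mult_eq_1)
  have "fps_deriv (fps_ln 1 oo F) = inverse ((1 + G) * (1 + H)) * fps_deriv F"
    using fps_deriv_ln_compose[OF F0] assms(1) by simp
  also have "\<dots> = (inverse (1 + G) * inverse (1 + H)) * (fps_deriv G * (1 + H) + (1 + G) * fps_deriv H)"
    unfolding F by (simp add: fps_inverse_mult)
  also have "\<dots> = inverse (1 + G) * fps_deriv G * (inverse (1 + H) * (1 + H))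
               + inverse (1 + H) * fps_deriv H * (inverse (1 + G) * (1 + G))"
    by (simp add: algebra_simps)
  also have "\<dots> = fps_deriv ((fps_ln 1 oo G) + (fps_ln 1 oo H))"
    using assms by (simp add: inv fps_deriv_ln_compose)
  finally show ?thesis
    unfolding fps_deriv_eq_iff using F0 assms by simp
qed

text \<open>\<open>fps_ln 1\<close> is the compositional inverse of exp - 1; \<open>G\<close> is
  then substituted by associativity of composition.\<close>

lemma fps_exp_ln_compose:
  fixes G :: "'a::field_char_0 fps"
  assumes "G $ 0 = 0"
  shows "fps_exp 1 oo (fps_ln 1 oo G) = 1 + G"
proof -
  have "(fps_exp 1 - 1 :: 'a fps) oo fps_ln 1 = fps_X"
    unfolding fps_ln_fps_exp_inv[OF one_neq_zero] by (rule fps_inv_right) auto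
  then have "(fps_exp 1 :: 'a fps) oo fps_ln 1 = 1 + fps_X"
    by (simp add: fps_compose_sub_distrib algebra_simps)
  then show ?thesis
    using assms by (simp add: fps_compose_assoc fps_compose_add_distrib)
qed

text \<open>For integers, 2d < n is the test 2d + 1 \<le> n made by \<open>Dtx\<close>, and
  \<open>high\<close> is its exact complement. Both regions are closed under addition.\<close>

abbreviation low :: "nat \<Rightarrow> int \<Rightarrow> bool" where "low n d \<equiv> 2 * d < int n"
abbreviation high :: "nat \<Rightarrow> int \<Rightarrow> bool" where "high n d \<equiv> int n \<le> 2 * d"

lemma sum_closed_low: "sum_closed low" and sum_closed_high: "sum_closed high"
  by (auto simp: sum_closed_def)

lemma Dtx_split:
  assumes "supported low P" "supported high Q"
  shows "Dtx (P + Q) = P"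
proof (rule fps_ext, rule fls_eqI)
  fix n d
  let ?c = "\<lambda>d. if 2 * d + 1 \<le> int n then (P + Q) $ n $$ d else 0"
  \<comment> \<open>\<open>Abs_fls\<close> needs a function that vanishes far to the left;
    truncation only deletes coefficients, so the subdegree of the full coefficient is a valid
    bound.\<close>
  have "Abs_fls ?c $$ d = ?c d"
    by (rule nth_Abs_fls_lower_bound[of "fls_subdegree ((P + Q) $ n)" ?c])
      (simp del: fps_add_nth fls_plus_nth)
  moreover have "P $ n $$ d = 0" if "\<not> low n d"
    using assms(1) that unfolding supported_def by blast
  moreover have "Q $ n $$ d = 0" if "low n d"
    using assms(2) that unfolding supported_def by (meson not_less)
  ultimately show "Dtx (P + Q) $ n $$ d = P $ n $$ d"
    by (auto simp: Dtx_def)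
qed

lemma exp_Dtx_ln:
  assumes "1 + F = C * B" "B $ 0 = 1" "C $ 0 = 1" "supported low (B - 1)" "supported high (C - 1)"
  shows "fexp (Dtx (fln1p F)) = B"
proof -
  have "fln1p F = (fps_ln 1 oo (B - 1)) + (fps_ln 1 oo (C - 1))"
    unfolding fln1p_def by (rule fps_ln_compose_mult) (use assms in \<open>auto simp: mult.commute\<close>)
  then have "Dtx (fln1p F) = fps_ln 1 oo (B - 1)"
    using assms by (simp add: Dtx_split supported_fps_ln_compose sum_closed_low sum_closed_high)
  then show ?thesis
    using assms by (simp add: fexp_def fps_exp_ln_compose)
qed

section \<open>The closed form as the solution of a Riccati equation\<close>

text \<open>Exponents add when binomial series are multiplied, and composition with
  \<open>f - 1\<close> is multiplicative because its constant term is 0.\<close>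

lemma fps_sqrt1_square:
  assumes "f $ 0 = 1"
  shows "fps_sqrt1 f ^ 2 = f"
proof -
  have "fps_sqrt1 f ^ 2 = (fps_binomial (1/2) * fps_binomial (1/2)) oo (f - 1)"
    using assms by (simp add: fps_sqrt1_def power2_eq_square fps_compose_mult_distrib)
  also have "fps_binomial (1/2) * fps_binomial (1/2) = (fps_binomial 1 :: 'a fps)"
    by (simp flip: fps_binomial_add_mult)
  finally show ?thesis
    using assms by (simp add: fps_binomial_1 fps_compose_add_distrib)
qed

lemma sqrt_term_square: "sqrt_term ^ 2 = (1 + tvar)^2 - 4 * yvar * tvar"
proof -
  have "sqrt_term ^ 2 = fps_to_fls (fps_sqrt1 ((1 + fps_X)^2 - 4 * fps_const fls_X * fps_X) ^ 2)"
    by (simp add: sqrt_term_def fps_to_fls_power)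
  also have "\<dots> = fps_to_fls ((1 + fps_X)^2 - 4 * fps_const fls_X * fps_X)"
    by (subst fps_sqrt1_square) (simp_all add: power2_eq_square)
  also have "\<dots> = (1 + tvar)^2 - 4 * yvar * tvar"
    by (simp add: fps_to_fls_power fls_times_fps_to_fls tvar_def yvar_def)
  finally show ?thesis .
qed

lemma tvar_nonzero: "tvar \<noteq> 0" and yvar_nonzero: "yvar \<noteq> 0" and yvar_neq_1: "yvar \<noteq> 1"
proof -
  \<comment> \<open>The coefficient of t^0 y^1 separates the two sides.\<close>
  have "(yvar $$ 0) $$ 1 \<noteq> ((1 :: coeff) $$ 0) $$ 1"
    by (simp add: yvar_def)
  then show "yvar \<noteq> 1"
    by metis
qed (auto simp: tvar_def yvar_def)

text \<open>Otherwise the radicand would vanish, but its coefficient at t^0 is 1.\<close>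

lemma sqrt_term_nonzero: "sqrt_term \<noteq> 0"
proof
  assume "sqrt_term = 0"
  then have "(1 + tvar)^2 - 4 * yvar * tvar = 0"
    using sqrt_term_square by simp
  moreover have "(1 + tvar)^2 - 4 * yvar * tvar = 1 + tvar * (2 + tvar - 4 * yvar)"
    by (simp add: power2_eq_square algebra_simps)
  moreover have "(1 + tvar * (2 + tvar - 4 * yvar)) $$ 0 = 1"
    by (simp add: tvar_def yvar_def fls_X_times_conv_shift flip: fls_const_numeral)
  ultimately show False
    by simp
qed

text \<open>
  The roots \<open>r\<close>, \<open>q\<close> of \<open>z\<^sup>2 - (1 + t) z + y t\<close> rationalise the closed form:
  \<open>v = r / q\<close>, \<open>u = (q - 1) / (1 - r)\<close> and \<open>w = exp ((q - r) x)\<close>.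
\<close>

definition r_ser :: coeff where "r_ser = (1 + tvar - sqrt_term) / 2"
definition q_ser :: coeff where "q_ser = (1 + tvar + sqrt_term) / 2"

lemma rq_add: "r_ser + q_ser = 1 + tvar"
  and rq_diff: "q_ser - r_ser = sqrt_term"
  by (simp_all add: r_ser_def q_ser_def field_simps)

lemma rq_mult: "r_ser * q_ser = yvar * tvar"
proof -
  have "4 * (r_ser * q_ser) = (1 + tvar)^2 - sqrt_term^2"
    by (simp add: r_ser_def q_ser_def field_simps power2_eq_square)
  then show ?thesis
    by (simp add: sqrt_term_square)
qed

lemma rq_nonzero: "r_ser \<noteq> 0" "q_ser \<noteq> 0" "q_ser - r_ser \<noteq> 0"
  using rq_mult rq_diff tvar_nonzero yvar_nonzero sqrt_term_nonzero by auto

text \<open>In terms of r + q, r q and q - r the numerator of \<open>v_ser\<close> collapses to 2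
  r^2.\<close>

lemma v_ser_eq: "v_ser = r_ser / q_ser"
proof -
  have "v_ser = ((r_ser + q_ser)^2 - 2 * (r_ser * q_ser) - (r_ser + q_ser) * (q_ser - r_ser))
          / (2 * (r_ser * q_ser))"
    unfolding v_ser_def rq_mult by (simp add: rq_add rq_diff mult.assoc)
  also have "\<dots> = 2 * r_ser^2 / (2 * (r_ser * q_ser))"
    by (rule arg_cong2[where f = "(/)"]) (simp_all add: algebra_simps power2_eq_square)
  finally show ?thesis
    using rq_nonzero by (simp add: power2_eq_square)
qed

text \<open>The quadratic with roots r and q, evaluated at z = 1; up to a factor -2 it is the
  denominator of \<open>u_ser\<close>.\<close>

lemma one_minus_rq: "(1 - r_ser) * (1 - q_ser) = - ((1 - yvar) * tvar)"
proof -
  have "(1 - r_ser) * (1 - q_ser) = 1 - (r_ser + q_ser) + r_ser * q_ser"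
    by (simp add: algebra_simps)
  then show ?thesis
    unfolding rq_add rq_mult by (simp add: algebra_simps)
qed

lemma one_minus_rq_nonzero: "1 - r_ser \<noteq> 0" "1 - q_ser \<noteq> 0"
  using one_minus_rq tvar_nonzero yvar_neq_1 by auto

lemma u_ser_eq: "u_ser = (q_ser - 1) / (1 - r_ser)"
proof -
  \<comment> \<open>Eliminating t turns the numerator into a polynomial in r and q that reduces to 2
    (1 - q)^2.\<close>
  have t: "tvar = r_ser + q_ser - 1"
    by (simp add: rq_add)
  have "u_ser = (1 + tvar^2 - 2 * (r_ser * q_ser) - (1 - tvar) * (q_ser - r_ser))
          / (2 * ((1 - yvar) * tvar))"
    unfolding u_ser_def rq_mult rq_diff by (simp add: mult.assoc)
  also have "1 + tvar^2 - 2 * (r_ser * q_ser) - (1 - tvar) * (q_ser - r_ser) = 2 * (1 - q_ser)^2"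
    unfolding t by (simp add: algebra_simps power2_eq_square)
  also have "(1 - yvar) * tvar = (1 - r_ser) * (q_ser - 1)"
    using one_minus_rq by (simp add: algebra_simps)
  also have "2 * (1 - q_ser)^2 / (2 * ((1 - r_ser) * (q_ser - 1))) = (q_ser - 1) / (1 - r_ser)"
  proof -
    have "2 * (1 - q_ser)^2 = (q_ser - 1) * (2 * (q_ser - 1))"
      by (simp add: power2_eq_square algebra_simps)
    moreover have "2 * ((1 - r_ser) * (q_ser - 1)) = (1 - r_ser) * (2 * (q_ser - 1))"
      by simp
    moreover have "2 * (q_ser - 1) \<noteq> 0"
      using one_minus_rq_nonzero by simp
    ultimately show ?thesis
      by (metis nonzero_mult_divide_mult_cancel_right)
  qed
  finally show ?thesis .
qed

text \<open>This quotient occurs both in the prefactor of \<open>F_ser\<close> and in the exponent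
  of \<open>w_ser\<close>.\<close>

lemma uv_ratio: "(1 + u_ser) / (1 + u_ser * v_ser) = q_ser"
proof -
  have 1: "1 + u_ser = (q_ser - r_ser) / (1 - r_ser)"
    unfolding u_ser_eq using one_minus_rq_nonzero by (simp add: divide_simps)
  have 2: "1 + u_ser * v_ser = (q_ser - r_ser) / ((1 - r_ser) * q_ser)"
    unfolding u_ser_eq v_ser_eq using one_minus_rq_nonzero rq_nonzero
    by (simp add: divide_simps) (simp add: algebra_simps)
  show ?thesis
    unfolding 1 2 using one_minus_rq_nonzero rq_nonzero by (simp add: divide_simps)
qed

lemma w_ser_eq: "w_ser = fps_exp (q_ser - r_ser)"
proof -
  have "(1 + u_ser) * (1 - v_ser) / (1 + u_ser * v_ser) = q_ser * (1 - r_ser / q_ser)"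
    unfolding v_ser_eq[symmetric] by (simp flip: uv_ratio)
  then show ?thesis
    using rq_nonzero by (simp add: w_ser_def algebra_simps)
qed

text \<open>The candidate for the series A: \<open>F_ser\<close> without its factor 1 + t, with q
  cleared from the denominator by v = r / q.\<close>

definition G_ser :: "coeff fps" where
  "G_ser = (w_ser - 1) * inverse (fps_const q_ser - fps_const r_ser * w_ser)"

lemma G_ser_mult: "G_ser * (fps_const q_ser - fps_const r_ser * w_ser) = w_ser - 1"
proof -
  have "(fps_const q_ser - fps_const r_ser * w_ser) $ 0 \<noteq> 0"
    using rq_nonzero by (simp add: w_ser_eq)
  then show ?thesis
    unfolding G_ser_def by (simp add: mult.assoc inverse_mult_eq_1)
qed

lemma F_ser_eq: "F_ser = fps_const (1 + tvar) * G_ser"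
proof -
  have coeff: "(1 + tvar) * (1 + u_ser) * v_ser / (yvar * tvar * (1 + u_ser * v_ser)) = (1 + tvar) / q_ser"
  proof -
    have "(1 + tvar) * (1 + u_ser) * v_ser / (yvar * tvar * (1 + u_ser * v_ser))
        = (1 + tvar) * ((1 + u_ser) / (1 + u_ser * v_ser)) * v_ser / (r_ser * q_ser)"
      unfolding rq_mult by simp
    also have "\<dots> = (1 + tvar) / q_ser"
      unfolding uv_ratio using rq_nonzero by (simp add: v_ser_eq)
    finally show ?thesis .
  qed
  have v: "1 - fps_const v_ser * w_ser = fps_const (1 / q_ser) * (fps_const q_ser - fps_const r_ser * w_ser)"
    unfolding v_ser_eq using rq_nonzero
    by (simp add: right_diff_distrib flip: mult.assoc)
  \<comment> \<open>A nonzero constant term lets the division in \<open>F_ser\<close> be read as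
    multiplication by an inverse.\<close>
  have "(1 - fps_const v_ser * w_ser) $ 0 \<noteq> 0"
    unfolding v using rq_nonzero by (simp add: w_ser_eq)
  then have "F_ser = fps_const ((1 + tvar) / q_ser) * (w_ser - 1) * inverse (1 - fps_const v_ser * w_ser)"
    by (simp add: F_ser_def coeff fps_divide_unit)
  also have "\<dots> = fps_const ((1 + tvar) / q_ser) * (w_ser - 1)
      * (fps_const q_ser * inverse (fps_const q_ser - fps_const r_ser * w_ser))"
    unfolding v fps_inverse_mult using rq_nonzero by (simp add: fps_const_inverse)
  also have "\<dots> = fps_const ((1 + tvar) / q_ser * q_ser) * G_ser"
    unfolding G_ser_def fps_const_mult[symmetric] by (simp only: ac_simps)
  finally show ?thesis
    using rq_nonzero by simp
qed

text \<open>The right-hand side factors as (1 + r G)(1 + q G). The identity G D = w - 1 is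
  differentiated, and \<open>D\<close>, with constant term q - r, is cancelled only at the
  end.\<close>

lemma G_ser_riccati:
  "fps_deriv G_ser = 1 + fps_const (1 + tvar) * G_ser + fps_const (yvar * tvar) * G_ser^2"
proof -
  let ?q = "fps_const q_ser" and ?r = "fps_const r_ser"
  define D where "D = ?q - ?r * w_ser"
  have GD: "G_ser * D = w_ser - 1"
    unfolding D_def by (rule G_ser_mult)
  have w': "fps_deriv w_ser = (?q - ?r) * w_ser"
    by (simp add: w_ser_eq)
  have D': "fps_deriv D = - (?r * ((?q - ?r) * w_ser))"
    by (simp add: D_def w')
  have qG: "(1 + ?q * G_ser) * D = (?q - ?r) * w_ser"
  proof -
    have "(1 + ?q * G_ser) * D = D + ?q * (G_ser * D)"
      by (simp add: algebra_simps)
    then show ?thesis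
      unfolding GD by (simp add: D_def algebra_simps del: fps_const_sub)
  qed
  have "fps_deriv G_ser * D + G_ser * fps_deriv D = fps_deriv w_ser"
    using arg_cong[OF GD, of fps_deriv] by (simp add: add.commute)
  then have "fps_deriv G_ser * D = (1 + ?r * G_ser) * ((?q - ?r) * w_ser)"
    unfolding D' w' by (simp add: algebra_simps)
  also have "\<dots> = ((1 + ?r * G_ser) * (1 + ?q * G_ser)) * D"
    unfolding qG[symmetric] by (simp add: ac_simps)
  finally have "fps_deriv G_ser = (1 + ?r * G_ser) * (1 + ?q * G_ser)"
  proof -
    assume *: "fps_deriv G_ser * D = (1 + ?r * G_ser) * (1 + ?q * G_ser) * D"
    have "D $ 0 \<noteq> 0"
      using rq_nonzero by (simp add: D_def w_ser_eq)
    then have "D \<noteq> 0"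
      by auto
    with * show ?thesis
      by simp
  qed
  also have "\<dots> = 1 + fps_const (r_ser + q_ser) * G_ser + fps_const (r_ser * q_ser) * G_ser^2"
    by (simp add: algebra_simps power2_eq_square flip: fps_const_add fps_const_mult)
  finally show ?thesis
    unfolding rq_add rq_mult .
qed

text \<open>Coefficient m of the right-hand side involves only coefficients up to m of the solution,
  and it equals m + 1 times the next one.\<close>

lemma riccati_unique:
  fixes G H :: "'a::field_char_0 fps"
  assumes G: "fps_deriv G = fps_const a + fps_const b * G + fps_const c * G^2"
    and H: "fps_deriv H = fps_const a + fps_const b * H + fps_const c * H^2"
    and "G $ 0 = H $ 0"
  shows "G = H"
proof (rule fps_ext)
  fix n
  show "G $ n = H $ n"
  proof (induction n rule: less_induct)
    case (less n)
    show ?case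
    proof (cases n)
      case (Suc m)
      have "(G^2) $ m = (H^2) $ m"
        unfolding power2_eq_square fps_mult_nth by (rule sum.cong) (use less Suc in auto)
      moreover have "G $ m = H $ m"
        using less Suc by simp
      ultimately have "fps_deriv G $ m = fps_deriv H $ m"
        unfolding G H by simp
      then show ?thesis
        using Suc by (simp del: of_nat_Suc)
    qed (use assms in simp)
  qed
qed

section \<open>Exponential generating functions of permutation statistics\<close>

definition egf :: "(nat list \<Rightarrow> 'a::field_char_0) \<Rightarrow> 'a fps" where
  "egf f = Abs_fps (\<lambda>n. (\<Sum>\<pi>\<in>permutations_of_set {1..n}. f \<pi>) / fact n)"

lemma egf_nth: "egf f $ n = (\<Sum>\<pi>\<in>permutations_of_set {1..n}. f \<pi>) / fact n"
  by (simp add: egf_def)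

lemma egf_cong:
  assumes "\<And>\<pi>. distinct \<pi> \<Longrightarrow> set \<pi> = {1..length \<pi>} \<Longrightarrow> f \<pi> = g \<pi>"
  shows "egf f = egf g"
proof (rule fps_ext)
  fix n
  have "f \<pi> = g \<pi>" if "\<pi> \<in> permutations_of_set {1..n}" for \<pi>
    using that length_finite_permutations_of_set[OF that]
    by (intro assms) (auto simp: permutations_of_set_def)
  then show "egf f $ n = egf g $ n"
    by (simp add: egf_nth)
qed

lemma egf_add: "egf (\<lambda>\<pi>. f \<pi> + g \<pi>) = egf f + egf g"
  by (rule fps_ext) (simp add: egf_nth sum.distrib add_divide_distrib)

lemma egf_const_mult: "egf (\<lambda>\<pi>. c * f \<pi>) = fps_const c * egf f"
  by (rule fps_ext) (simp add: egf_nth flip: sum_distrib_left)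

lemma egf_Nil: "egf (\<lambda>\<pi>. of_bool (\<pi> = [])) = 1"
proof (rule fps_ext)
  fix n :: nat
  have "(\<Sum>\<pi>\<in>permutations_of_set {1..n}. of_bool (\<pi> = [])) = (of_bool (n = 0) :: 'a)"
  proof (cases "n = 0")
    case False
    then have "1 \<in> {1..n}"
      by (simp add: Suc_le_eq)
    then have "[] \<notin> permutations_of_set {1..n}"
      unfolding permutations_of_set_def by force
    then show ?thesis
      using False by (auto intro!: sum.neutral)
  qed simp
  then show "egf (\<lambda>\<pi>. of_bool (\<pi> = [])) $ n = (1 :: 'a fps) $ n"
    by (simp add: egf_nth)
qed

text \<open>Prefixes and suffixes of a permutation are not permutations of an initial segment; such
  weights see only their relative order.\<close>

definition relabel_invariant :: "(nat list \<Rightarrow> 'a) \<Rightarrow> bool" where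
  "relabel_invariant f \<longleftrightarrow> (\<forall>g \<pi>. strict_mono_on (set \<pi>) g \<longrightarrow> f (map g \<pi>) = f \<pi>)"

lemma sum_permutations_lessThan:
  assumes "relabel_invariant f" "finite S"
  shows "sum f (permutations_of_set S) = sum f (permutations_of_set {..<card S})"
proof -
  obtain h where h: "bij_betw h {..<card S} S" "strict_mono_on {..<card S} h"
    using ex_bij_betw_strict_mono_card[OF assms(2)] by metis
  then have inj: "inj_on h {..<card S}" and im: "h ` {..<card S} = S"
    by (auto simp: bij_betw_def)
  have "permutations_of_set S = map h ` permutations_of_set {..<card S}"
    using permutations_of_set_image_inj[OF inj] im by simp
  moreover have "inj_on (map h) (permutations_of_set {..<card S})"
    by (rule inj_onI) (metis inj map_inj_on permutations_of_setD(1) Un_absorb)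
  ultimately have "sum f (permutations_of_set S) = (\<Sum>\<pi>\<in>permutations_of_set {..<card S}. f (map h \<pi>))"
    by (simp add: sum.reindex)
  also have "\<dots> = sum f (permutations_of_set {..<card S})"
    using assms(1) h(2) unfolding relabel_invariant_def
    by (intro sum.cong) (auto simp: permutations_of_set_def)
  finally show ?thesis .
qed

lemma sum_permutations_card:
  assumes "relabel_invariant f" "finite S"
  shows "sum f (permutations_of_set S) = sum f (permutations_of_set {1..card S})"
  using sum_permutations_lessThan[OF assms] sum_permutations_lessThan[OF assms(1), of "{1..card S}"]
  by simp

text \<open>Cutting an arrangement of \<open>A\<close> in two amounts to choosing the letter set
  \<open>S\<close> of the prefix and arranging \<open>S\<close> and \<open>A - S\<close>
  independently.\<close>

lemma sum_splits:
  fixes f g :: "'b list \<Rightarrow> 'a::comm_semiring_1"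
  assumes "finite A"
  shows "(\<Sum>\<pi>\<in>permutations_of_set A. \<Sum>i\<le>length \<pi>. f (take i \<pi>) * g (drop i \<pi>))
       = (\<Sum>S\<in>Pow A. sum f (permutations_of_set S) * sum g (permutations_of_set (A - S)))"
proof -
  let ?P = permutations_of_set
  have "(\<Sum>S\<in>Pow A. sum f (?P S) * sum g (?P (A - S)))
      = (\<Sum>(S, \<sigma>, \<tau>)\<in>(SIGMA S:Pow A. ?P S \<times> ?P (A - S)). f \<sigma> * g \<tau>)"
    using assms by (simp add: sum_product sum.cartesian_product sum.Sigma)
  also have "\<dots> = (\<Sum>(\<pi>, i)\<in>(SIGMA \<pi>:?P A. {..length \<pi>}). f (take i \<pi>) * g (drop i \<pi>))"
  proof (rule sum.reindex_bij_witness[where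
          i = "\<lambda>(\<pi>, i). (set (take i \<pi>), take i \<pi>, drop i \<pi>)" and
          j = "\<lambda>(S, \<sigma>, \<tau>). (\<sigma> @ \<tau>, length \<sigma>)"], goal_cases)
    \<comment> \<open>The obligation with content: the letters of the two pieces partition
      \<open>A\<close>.\<close>
    case (4 b)
    obtain \<pi> i where b: "b = (\<pi>, i)" by fastforce
    have "set (take i \<pi>) \<inter> set (drop i \<pi>) = {}"
      using 4 by (intro set_take_disj_set_drop_if_distinct) (auto simp: b permutations_of_set_def)
    moreover have "set (take i \<pi>) \<union> set (drop i \<pi>) = A"
      using 4 by (simp add: b permutations_of_set_def flip: set_append)
    ultimately show ?case
      using 4 by (auto simp: b permutations_of_set_def)
  qed (auto simp: permutations_of_set_def)
  also have "\<dots> = (\<Sum>\<pi>\<in>?P A. \<Sum>i\<le>length \<pi>. f (take i \<pi>) * g (drop i \<pi>))"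
    using assms by (simp add: sum.Sigma)
  finally show ?thesis ..
qed

lemma sum_Pow_card:
  fixes F :: "nat \<Rightarrow> 'a::comm_semiring_1"
  assumes "finite A"
  shows "(\<Sum>S\<in>Pow A. F (card S)) = (\<Sum>k\<le>card A. of_nat (card A choose k) * F k)"
proof -
  have "(\<Sum>S\<in>Pow A. F (card S)) = (\<Sum>k\<le>card A. \<Sum>S\<in>{S. S \<in> Pow A \<and> card S = k}. F (card S))"
    by (rule sum.group[symmetric]) (auto simp: assms card_mono)
  also have "\<dots> = (\<Sum>k\<le>card A. \<Sum>S\<in>{S. S \<subseteq> A \<and> card S = k}. F k)"
    by (intro sum.cong) auto
  also have "\<dots> = (\<Sum>k\<le>card A. of_nat (card A choose k) * F k)"
    by (simp add: n_subsets[OF assms])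
  finally show ?thesis .
qed

text \<open>By invariance only the size k of the prefix matters; its (n choose k) letter sets give
  the binomial convolution of exponential generating functions.\<close>

lemma egf_mult:
  fixes f g :: "nat list \<Rightarrow> 'a::field_char_0"
  assumes "relabel_invariant f" "relabel_invariant g"
  shows "egf f * egf g = egf (\<lambda>\<pi>. \<Sum>i\<le>length \<pi>. f (take i \<pi>) * g (drop i \<pi>))"
proof (rule fps_ext)
  fix n
  define a where "a k = sum f (permutations_of_set {1..k})" for k
  define b where "b k = sum g (permutations_of_set {1..k})" for k
  have "(\<Sum>\<pi>\<in>permutations_of_set {1..n}. \<Sum>i\<le>length \<pi>. f (take i \<pi>) * g (drop i \<pi>))
      = (\<Sum>S\<in>Pow {1..n}. a (card S) * b (n - card S))"
    unfolding sum_splits[OF finite_atLeastAtMost] a_def b_def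
  proof (rule sum.cong)
    fix S assume "S \<in> Pow {1..n}"
    then have "finite S" "card ({1..n} - S) = n - card S"
      by (auto simp: card_Diff_subset finite_subset)
    then show "sum f (permutations_of_set S) * sum g (permutations_of_set ({1..n} - S))
        = sum f (permutations_of_set {1..card S}) * sum g (permutations_of_set {1..n - card S})"
      using sum_permutations_card[OF assms(1), of S] sum_permutations_card[OF assms(2), of "{1..n} - S"]
      by simp
  qed simp
  also have "\<dots> = (\<Sum>k\<le>n. of_nat (n choose k) * (a k * b (n - k)))"
    using sum_Pow_card[of "{1..n}" "\<lambda>k. a k * b (n - k)"] by simp
  also have "\<dots> = (\<Sum>k\<le>n. fact n * ((a k / fact k) * (b (n - k) / fact (n - k))))"
    by (intro sum.cong) (auto simp: binomial_fact)
  also have "\<dots> = fact n * (egf f * egf g) $ n"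
    by (simp add: fps_mult_nth egf_nth a_def b_def atLeast0AtMost sum_distrib_left)
  finally show "(egf f * egf g) $ n = egf (\<lambda>\<pi>. \<Sum>i\<le>length \<pi>. f (take i \<pi>) * g (drop i \<pi>)) $ n"
    by (simp add: egf_nth)
qed

text \<open>Inserting the letter n + 1 into the permutations of [n] yields each permutation of
  [n + 1] exactly once.\<close>

lemma egf_deriv:
  fixes f :: "nat list \<Rightarrow> 'a::field_char_0"
  shows "fps_deriv (egf f) = egf (\<lambda>\<pi>. \<Sum>i\<le>length \<pi>. f (take i \<pi> @ Suc (length \<pi>) # drop i \<pi>))"
proof (rule fps_ext)
  fix n
  let ?P = permutations_of_set
  let ?ins = "\<lambda>(\<pi>, i). take i \<pi> @ Suc (length \<pi>) # drop i \<pi>"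
  have inj: "inj_on ?ins (SIGMA \<pi>:?P {1..n}. {..length \<pi>})"
  proof (rule inj_onI, clarify)
    fix \<pi> i \<rho> j
    assume *: "\<pi> \<in> ?P {1..n}" "\<rho> \<in> ?P {1..n}" "i \<le> length \<pi>" "j \<le> length \<rho>"
      and eq: "take i \<pi> @ Suc (length \<pi>) # drop i \<pi> = take j \<rho> @ Suc (length \<rho>) # drop j \<rho>"
    from *(1,2) have len: "length \<pi> = n" "length \<rho> = n"
      by (auto simp: length_finite_permutations_of_set)
    \<comment> \<open>Since the new letter lies in neither piece, its position recovers both pieces
      and the cut.\<close>
    have "Suc n \<notin> set \<pi>"
      using *(1) by (auto simp: permutations_of_set_def)
    then have "Suc n \<notin> set (take i \<pi>)" "Suc n \<notin> set (drop i \<pi>)"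
      by (auto dest: in_set_takeD in_set_dropD)
    then have "take i \<pi> = take j \<rho>" "drop i \<pi> = drop j \<rho>"
      using eq unfolding len by (simp_all add: append_Cons_eq_iff)
    moreover from this have "i = j"
      using *(3,4) len by (metis length_take min.absorb2)
    ultimately show "\<pi> = \<rho> \<and> i = j"
      by (metis append_take_drop_id)
  qed
  have im: "?ins ` (SIGMA \<pi>:?P {1..n}. {..length \<pi>}) = ?P {1..Suc n}"
  proof (rule set_eqI, rule iffI)
    fix \<rho> assume "\<rho> \<in> ?ins ` (SIGMA \<pi>:?P {1..n}. {..length \<pi>})"
    then obtain \<pi> i where \<pi>: "\<pi> \<in> ?P {1..n}" and \<rho>: "\<rho> = take i \<pi> @ Suc (length \<pi>) # drop i \<pi>"
      by auto
    from \<pi> have d: "distinct (take i \<pi> @ drop i \<pi>)" and s: "set (take i \<pi> @ drop i \<pi>) = {1..n}"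
      by (simp_all add: permutations_of_set_def)
    have "length \<pi> = n"
      using \<pi> by (simp add: length_finite_permutations_of_set)
    moreover have "Suc n \<notin> set (take i \<pi>)" "Suc n \<notin> set (drop i \<pi>)"
      using \<pi> by (auto simp: permutations_of_set_def dest: in_set_takeD in_set_dropD)
    moreover have "{1..Suc n} = insert (Suc n) {1..n}"
      by auto
    ultimately show "\<rho> \<in> ?P {1..Suc n}"
      using d s unfolding \<rho> permutations_of_set_def set_append distinct_append
      by (simp del: atLeastAtMost_iff)
  next
    fix \<rho> assume \<rho>: "\<rho> \<in> ?P {1..Suc n}"
    then have "Suc n \<in> set \<rho>"
      by (simp add: permutations_of_set_def)
    then obtain xs ys where xy: "\<rho> = xs @ Suc n # ys"
      using split_list by fast
    with \<rho> have "set (xs @ ys) = {1..Suc n} - {Suc n}" "distinct (xs @ ys)"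
      by (auto simp: permutations_of_set_def)
    then have "xs @ ys \<in> ?P {1..n}"
      by (auto simp: permutations_of_set_def)
    moreover from this have "length (xs @ ys) = n"
      by (simp only: length_finite_permutations_of_set) simp
    ultimately show "\<rho> \<in> ?ins ` (SIGMA \<pi>:?P {1..n}. {..length \<pi>})"
      using xy by (intro image_eqI[of _ _ "(xs @ ys, length xs)"]) auto
  qed
  have "sum f (?P {1..Suc n}) = (\<Sum>(\<pi>, i)\<in>(SIGMA \<pi>:?P {1..n}. {..length \<pi>}). f (?ins (\<pi>, i)))"
    unfolding im[symmetric] sum.reindex[OF inj] by (simp add: case_prod_unfold)
  also have "\<dots> = (\<Sum>\<pi>\<in>?P {1..n}. \<Sum>i\<le>length \<pi>. f (?ins (\<pi>, i)))"
    by (simp add: sum.Sigma)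
  finally show "fps_deriv (egf f) $ n = egf (\<lambda>\<pi>. \<Sum>i\<le>length \<pi>. f (take i \<pi> @ Suc (length \<pi>) # drop i \<pi>)) $ n"
    by (simp add: egf_nth del: of_nat_Suc)
qed

section \<open>Descents, peaks and the walk of a permutation\<close>

lemma card_upto_sum:
  "card {i. i + 1 < (n :: nat) \<and> P i} = (\<Sum>i<n - 1. of_bool (P i))"
proof -
  have "{i. i + 1 < n \<and> P i} = {..<n - 1} \<inter> {i. P i}"
    by auto
  then show ?thesis
    by (simp add: sum_of_bool_eq)
qed

lemma des_sum: "des \<pi> = (\<Sum>i<length \<pi> - 1. of_bool (\<pi> ! i > \<pi> ! (i + 1)))"
  and asc_sum: "asc \<pi> = (\<Sum>i<length \<pi> - 1. of_bool (\<pi> ! i < \<pi> ! (i + 1)))"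
  unfolding des_def asc_def by (rule card_upto_sum)+

text \<open>A peak is indexed here by its left neighbour, which avoids the predecessor
  \<open>i - 1\<close>.\<close>

lemma pk_sum: "pk \<pi> = (\<Sum>i<length \<pi> - 2. of_bool (\<pi> ! i < \<pi> ! (i + 1) \<and> \<pi> ! (i + 1) > \<pi> ! (i + 2)))"
proof -
  have "{i. 0 < i \<and> i + 1 < length \<pi> \<and> \<pi> ! (i - 1) < \<pi> ! i \<and> \<pi> ! i > \<pi> ! (i + 1)}
      = Suc ` {i. i + 1 < length \<pi> - 1 \<and> (\<pi> ! i < \<pi> ! (i + 1) \<and> \<pi> ! (i + 1) > \<pi> ! (i + 2))}"
    (is "?A = Suc ` ?B")
  proof (rule set_eqI)
    fix i show "i \<in> ?A \<longleftrightarrow> i \<in> Suc ` ?B"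
      by (cases i) auto
  qed
  then have "pk \<pi> = card ?B"
    unfolding pk_def by (simp add: card_image)
  then show ?thesis
    unfolding card_upto_sum by (simp add: numeral_2_eq_2)
qed

lemma des_Nil [simp]: "des [] = 0" and des_single [simp]: "des [x] = 0"
  and pk_Nil [simp]: "pk [] = 0" and pk_single [simp]: "pk [x] = 0"
  by (simp_all add: des_sum pk_sum)

lemma des_Cons: "ys \<noteq> [] \<Longrightarrow> des (x # ys) = des ys + of_bool (x > hd ys)"
  by (cases ys) (simp_all add: des_sum sum.lessThan_Suc_shift del: sum.lessThan_Suc)

lemma pk_Cons: "pk (x # ys) = pk ys + of_bool (length ys \<ge> 2 \<and> x < ys ! 0 \<and> ys ! 0 > ys ! 1)"
proof -
  consider "ys = []" | z where "ys = [z]" | a b zs where "ys = a # b # zs"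
    by (metis neq_Nil_conv)
  then show ?thesis
    by cases (simp_all add: pk_sum sum.lessThan_Suc_shift del: sum.lessThan_Suc)
qed

lemma des_append:
  assumes "xs \<noteq> []" "ys \<noteq> []"
  shows "des (xs @ ys) = des xs + des ys + of_bool (last xs > hd ys)"
  using assms(1) by (induction xs rule: list_nonempty_induct) (simp_all add: des_Cons assms)

text \<open>Only the two letters at the junction can become new peaks; the length guards ensure that
  such a letter also has a neighbour in its own piece.\<close>

lemma pk_append:
  assumes "xs \<noteq> []" "ys \<noteq> []"
  shows "pk (xs @ ys) = pk xs + pk ys
    + of_bool (length xs \<ge> 2 \<and> xs ! (length xs - 2) < last xs \<and> last xs > hd ys)
    + of_bool (length ys \<ge> 2 \<and> last xs < hd ys \<and> hd ys > ys ! 1)"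
  using assms(1)
proof (induction xs rule: list_nonempty_induct)
  case (single x)
  then show ?case
    using assms by (simp add: pk_Cons hd_conv_nth)
next
  case (cons x xs)
  show ?case
  proof (cases "length xs = 1")
    case True
    then obtain z where z: "xs = [z]"
      by (metis One_nat_def Suc_length_conv length_0_conv)
    show ?thesis
      using assms cons.IH unfolding z by (cases ys) (auto simp: pk_Cons)
  next
    case False
    with cons.hyps have "length xs \<ge> 2"
      by (cases xs) (auto simp: Suc_le_eq)
    then show ?thesis
      using cons by (simp add: pk_Cons nth_append numeral_2_eq_2)
  qed
qed

section \<open>The walk of a permutation and the ballot conditions\<close>

definition step :: "nat list \<Rightarrow> nat \<Rightarrow> int" where
  "step xs i = of_bool (xs ! i < xs ! (i + 1)) - of_bool (xs ! i > xs ! (i + 1))"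

text \<open>The height is read at the letter with 0-based index \<open>k\<close>, so a list of
  length n > 0 has the heights 0 to n - 1 to compare.\<close>

definition height :: "nat list \<Rightarrow> nat \<Rightarrow> int" where
  "height xs k = (\<Sum>i<k. step xs i)"

lemma height_Suc: "height xs (Suc k) = height xs k + step xs k"
  by (simp add: height_def)

lemma asc_minus_des: "int (asc xs) - int (des xs) = height xs (length xs - 1)"
  by (simp add: asc_sum des_sum height_def step_def sum_subtractf)

lemma height_add: "height xs (i + k) = height xs i + (\<Sum>m<k. step xs (i + m))"
  by (induction k) (simp_all add: height_Suc)

text \<open>A slice of \<open>k\<close> letters contains only \<open>k - 1\<close> steps, hence the
  endpoint \<open>i + k - 1\<close>.\<close>

lemma balance_slice:
  assumes "i + k \<le> length xs" "k > 0"
  shows "int (asc (take k (drop i xs))) - int (des (take k (drop i xs)))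
       = height xs (i + k - 1) - height xs i"
proof -
  have "height (take k (drop i xs)) (k - 1) = (\<Sum>m<k - 1. step xs (i + m))"
    unfolding height_def step_def by (rule sum.cong) (use assms in \<open>auto simp: add.commute add.left_commute\<close>)
  moreover have "i + k - 1 = i + (k - 1)"
    using assms by simp
  ultimately show ?thesis
    using assms by (simp only: asc_minus_des height_add) simp
qed

lemma asc_des_Nil: "asc [] = des []"
  by (simp add: asc_sum des_sum)

text \<open>The nonempty prefixes of the suffix end at the indices j \<ge> i, and each has balance
  equal to the rise from i to j.\<close>

lemma is_ballot_drop_iff:
  assumes "i < length xs"
  shows "is_ballot (drop i xs) \<longleftrightarrow> (\<forall>j. i \<le> j \<and> j < length xs \<longrightarrow> height xs i \<le> height xs j)"
proof
  assume *: "is_ballot (drop i xs)"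
  show "\<forall>j. i \<le> j \<and> j < length xs \<longrightarrow> height xs i \<le> height xs j"
  proof (intro allI impI)
    fix j assume j: "i \<le> j \<and> j < length xs"
    then have "des (take (j - i + 1) (drop i xs)) \<le> asc (take (j - i + 1) (drop i xs))"
      using * unfolding is_ballot_def by (simp add: less_diff_conv2 Suc_diff_le Suc_le_eq)
    then show "height xs i \<le> height xs j"
      using balance_slice[of i "j - i + 1" xs] j by simp
  qed
next
  assume *: "\<forall>j. i \<le> j \<and> j < length xs \<longrightarrow> height xs i \<le> height xs j"
  show "is_ballot (drop i xs)"
    unfolding is_ballot_def
  proof (intro allI impI)
    fix k assume k: "k \<le> length (drop i xs)"
    show "des (take k (drop i xs)) \<le> asc (take k (drop i xs))"
    proof (cases "k = 0")
      case False
      then have len: "i + k \<le> length xs" and "i \<le> i + k - 1 \<and> i + k - 1 < length xs"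
        using k assms unfolding length_drop by linarith+
      then have "height xs i \<le> height xs (i + k - 1)"
        using * by blast
      then show ?thesis
        using balance_slice[OF len] False by simp
    qed (simp add: asc_des_Nil)
  qed
qed

text \<open>Equivalently the reversed list is ballot, as reversal exchanges ascents and
  descents.\<close>

definition is_coballot :: "nat list \<Rightarrow> bool" where
  "is_coballot xs \<longleftrightarrow> (\<forall>i\<le>length xs. asc (drop i xs) \<le> des (drop i xs))"

text \<open>All nonempty suffixes of the prefix end at index \<open>k - 1\<close>, so the walk must
  attain its minimum there.\<close>

lemma is_coballot_take_iff:
  assumes "0 < k" "k \<le> length xs"
  shows "is_coballot (take k xs) \<longleftrightarrow> (\<forall>j<k. height xs (k - 1) \<le> height xs j)"
proof -
  have "asc (drop j (take k xs)) \<le> des (drop j (take k xs)) \<longleftrightarrow> height xs (k - 1) \<le> height xs j"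
    if "j < k" for j
    using balance_slice[of j "k - j" xs] assms that by (auto simp: drop_take)
  moreover have "drop k (take k xs) = []"
    by simp
  moreover have "(\<forall>j\<le>k. P j) \<longleftrightarrow> (\<forall>j<k. P j) \<and> P k" for P
    by (auto simp: le_less)
  ultimately show ?thesis
    using assms unfolding is_coballot_def by (simp add: asc_des_Nil)
qed

text \<open>Converts comparisons of \<open>asc\<close> with \<open>des\<close> into comparisons of
  \<open>des\<close> with the length, as \<open>low\<close> and \<open>high\<close> require.\<close>

lemma asc_des_distinct:
  assumes "distinct xs" "xs \<noteq> []"
  shows "asc xs + des xs + 1 = length xs"
proof -
  have "asc xs + des xs = (\<Sum>i<length xs - 1. 1)"
    unfolding asc_sum des_sum sum.distrib[symmetric]
  proof (rule sum.cong)
    fix i assume "i \<in> {..<length xs - 1}"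
    then have "xs ! i \<noteq> xs ! (i + 1)"
      using assms by (simp add: nth_eq_iff_index_eq)
    then show "of_bool (xs ! i < xs ! (i + 1)) + of_bool (xs ! (i + 1) < xs ! i) = (1 :: nat)"
      by auto
  qed simp
  then show ?thesis
    using assms by simp
qed

context
  fixes g :: "nat \<Rightarrow> nat" and xs
  assumes mono: "strict_mono_on (set xs) g"
begin

lemma map_strict_mono_less: "i < length xs \<Longrightarrow> j < length xs \<Longrightarrow> g (xs ! i) < g (xs ! j) \<longleftrightarrow> xs ! i < xs ! j"
  by (intro strict_mono_on_less[OF mono]) auto

lemma des_map: "des (map g xs) = des xs" and asc_map: "asc (map g xs) = asc xs"
  unfolding des_sum asc_sum by (auto simp: map_strict_mono_less intro!: sum.cong)

lemma pk_map: "pk (map g xs) = pk xs"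
  unfolding pk_sum by (auto simp: map_strict_mono_less intro!: sum.cong)

end

lemma is_ballot_map:
  assumes "strict_mono_on (set xs) g"
  shows "is_ballot (map g xs) \<longleftrightarrow> is_ballot xs"
proof -
  have "strict_mono_on (set (take i xs)) g" for i
    using assms set_take_subset by (rule monotone_on_subset)
  then show ?thesis
    by (simp add: is_ballot_def take_map asc_map des_map)
qed

lemma is_coballot_map:
  assumes "strict_mono_on (set xs) g"
  shows "is_coballot (map g xs) \<longleftrightarrow> is_coballot xs"
proof -
  have "strict_mono_on (set (drop i xs)) g" for i
    using assms set_drop_subset by (rule monotone_on_subset)
  then show ?thesis
    by (simp add: is_coballot_def drop_map asc_map des_map)
qed

section \<open>Peak-descent weights\<close>

definition wt :: "nat list \<Rightarrow> coeff" where
  "wt \<pi> = yvar ^ pk \<pi> * tvar ^ des \<pi>"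

lemma wt_Nil [simp]: "wt [] = 1" and wt_single [simp]: "wt [x] = 1"
  by (simp_all add: wt_def)

definition wt1 :: "nat list \<Rightarrow> coeff" where
  "wt1 \<pi> = of_bool (\<pi> \<noteq> []) * wt \<pi>"

definition wt_ballot :: "nat list \<Rightarrow> coeff" where
  "wt_ballot \<pi> = of_bool (is_ballot \<pi>) * wt \<pi>"

text \<open>The extra t makes the exponent des + 1; without it a list with asc = des would fall
  outside \<open>high\<close>.\<close>

definition wt_coballot :: "nat list \<Rightarrow> coeff" where
  "wt_coballot \<pi> = (if \<pi> = [] then 1 else of_bool (is_coballot \<pi>) * (tvar * wt \<pi>))"

lemma relabel_invariant_Nil: "relabel_invariant (\<lambda>\<pi>. of_bool (\<pi> = []))"
  by (simp add: relabel_invariant_def)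

lemma relabel_invariant_weights:
  "relabel_invariant wt1" "relabel_invariant wt_ballot" "relabel_invariant wt_coballot"
  by (simp_all add: relabel_invariant_def wt1_def wt_ballot_def wt_coballot_def wt_def
      des_map pk_map is_ballot_map is_coballot_map)

text \<open>The last two hypotheses exclude new peaks at the junction, so only a descent there
  alters the product.\<close>

lemma wt_append:
  assumes "xs \<noteq> []" "ys \<noteq> []" "last xs \<noteq> hd ys"
    and "last xs > hd ys \<Longrightarrow> length xs \<ge> 2 \<Longrightarrow> \<not> xs ! (length xs - 2) < last xs"
    and "last xs < hd ys \<Longrightarrow> length ys \<ge> 2 \<Longrightarrow> \<not> ys ! 1 < hd ys"
  shows "wt (xs @ ys) = (if last xs > hd ys then tvar else 1) * (wt xs * wt ys)"
  using assms by (auto simp: wt_def des_append pk_append power_add)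

text \<open>The maximum creates a descent iff a letter follows it and a peak iff it has letters on
  both sides. The four summands are the four emptiness cases, each ready to become a product of
  series.\<close>

lemma wt_insert_max:
  assumes "\<And>x. x \<in> set \<sigma> \<union> set \<tau> \<Longrightarrow> x < m"
  shows "wt (\<sigma> @ m # \<tau>) =
      of_bool (\<sigma> = []) * of_bool (\<tau> = []) + tvar * (of_bool (\<sigma> = []) * wt1 \<tau>)
    + (wt1 \<sigma> * of_bool (\<tau> = []) + (yvar * tvar) * (wt1 \<sigma> * wt1 \<tau>))"
proof -
  have wt_m: "wt (m # \<tau>) = (if \<tau> = [] then 1 else tvar * wt \<tau>)"
  proof (cases "\<tau> = []")
    case False
    then have "hd \<tau> < m"
      using assms by simp
    then show ?thesis
      using False by (auto simp: wt_def des_Cons pk_Cons hd_conv_nth)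
  qed simp
  show ?thesis
  proof (cases "\<sigma> = []")
    case False
    then have "last \<sigma> < m"
      using assms by simp
    moreover have "length (m # \<tau>) \<ge> 2 \<and> m > (m # \<tau>) ! 1 \<longleftrightarrow> \<tau> \<noteq> []"
      using assms by (cases \<tau>) auto
    ultimately have "wt (\<sigma> @ m # \<tau>) = (if \<tau> = [] then 1 else yvar) * (wt \<sigma> * wt (m # \<tau>))"
      using False by (auto simp: wt_def des_append pk_append power_add)
    then show ?thesis
      using False by (simp add: wt_m wt1_def)
  qed (simp add: wt_m wt1_def)
qed

lemma egf_wt1_riccati:
  "fps_deriv (egf wt1) = 1 + fps_const (1 + tvar) * egf wt1 + fps_const (yvar * tvar) * egf wt1 ^ 2"
proof -
  let ?e = "\<lambda>\<pi> :: nat list. of_bool (\<pi> = []) :: coeff"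
  let ?S = "\<lambda>f g \<pi>. \<Sum>i\<le>length \<pi>. f (take i \<pi>) * g (drop i \<pi>) :: coeff"
  have "fps_deriv (egf wt1) = egf (\<lambda>\<pi>. \<Sum>i\<le>length \<pi>. wt1 (take i \<pi> @ Suc (length \<pi>) # drop i \<pi>))"
    by (rule egf_deriv)
  also have "\<dots> = egf (\<lambda>\<pi>. (?S ?e ?e \<pi> + tvar * ?S ?e wt1 \<pi>) + (?S wt1 ?e \<pi> + (yvar * tvar) * ?S wt1 wt1 \<pi>))"
  proof (rule egf_cong)
    fix \<pi> :: "nat list"
    assume "set \<pi> = {1..length \<pi>}"
    then have "x < Suc (length \<pi>)" if "x \<in> set (take i \<pi>) \<union> set (drop i \<pi>)" for i x
      using that by (force dest: in_set_takeD in_set_dropD)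
    then have "wt1 (take i \<pi> @ Suc (length \<pi>) # drop i \<pi>)
        = (?e (take i \<pi>) * ?e (drop i \<pi>) + tvar * (?e (take i \<pi>) * wt1 (drop i \<pi>)))
        + (wt1 (take i \<pi>) * ?e (drop i \<pi>) + (yvar * tvar) * (wt1 (take i \<pi>) * wt1 (drop i \<pi>)))" for i
      by (subst wt1_def, subst wt_insert_max) simp_all
    then show "(\<Sum>i\<le>length \<pi>. wt1 (take i \<pi> @ Suc (length \<pi>) # drop i \<pi>))
        = (?S ?e ?e \<pi> + tvar * ?S ?e wt1 \<pi>) + (?S wt1 ?e \<pi> + (yvar * tvar) * ?S wt1 wt1 \<pi>)"
      by (simp only: sum.distrib sum_distrib_left)
  qed
  also have "\<dots> = (egf ?e * egf ?e + fps_const tvar * (egf ?e * egf wt1))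
      + (egf wt1 * egf ?e + fps_const (yvar * tvar) * (egf wt1 * egf wt1))"
    by (simp add: egf_add egf_const_mult egf_mult relabel_invariant_Nil relabel_invariant_weights
        del: fps_const_mult)
  also have "\<dots> = 1 + fps_const (1 + tvar) * egf wt1 + fps_const (yvar * tvar) * egf wt1 ^ 2"
    by (simp add: egf_Nil power2_eq_square algebra_simps flip: fps_const_add)
  finally show ?thesis .
qed


section \<open>The two admissible cuts of a nonempty permutation\<close>

lemma wt_splits:
  assumes "distinct xs" "xs \<noteq> []"
  shows "(\<Sum>i\<le>length xs. wt_coballot (take i xs) * wt_ballot (drop i xs)) = (1 + tvar) * wt xs"
proof -
  let ?n = "length xs" and ?h = "height xs"
  let ?f = "\<lambda>i. wt_coballot (take i xs) * wt_ballot (drop i xs)"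
  let ?M = "{k. k < ?n \<and> (\<forall>j<?n. ?h k \<le> ?h j)}"
  have n: "?n > 0" and fin: "finite ?M"
    using assms by simp_all
  have "Min (?h ` {..<?n}) \<in> ?h ` {..<?n}"
    using n by (intro Min_in) auto
  then obtain k where "k < ?n" "?h k = Min (?h ` {..<?n})"
    by auto
  then have "k \<in> ?M"
    by simp
  then have ne: "?M \<noteq> {}"
    by blast
  \<comment> \<open>The letter \<open>i\<close> opens the suffix of the cut at \<open>i\<close>; so
    \<open>p\<close> cuts before the first minimum and \<open>Suc q\<close> after the last.\<close>
  define p where "p = Min ?M"
  define q where "q = Max ?M"
  have p: "p < ?n" "\<And>j. j < ?n \<Longrightarrow> ?h p \<le> ?h j" and q: "q < ?n" "\<And>j. j < ?n \<Longrightarrow> ?h q \<le> ?h j"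
    using Min_in[OF fin ne] Max_in[OF fin ne] by (auto simp: p_def q_def)
  have p_first: "p \<le> k" and q_last: "k \<le> q" if "k < ?n" "\<And>j. j < ?n \<Longrightarrow> ?h k \<le> ?h j" for k
    using that fin by (auto simp: p_def q_def intro!: Min_le Max_ge)
  have hpq: "?h p = ?h q"
    using p q by (meson order_antisym)
  have "p \<le> q"
    using p q_last by blast
  have p_strict: "?h p < ?h j" if "j < p" for j
  proof (rule ccontr)
    assume "\<not> ?h p < ?h j"
    then have "p \<le> j"
      using that p(1) order_trans[OF _ p(2)] by (intro p_first) auto
    then show False
      using that by simp
  qed
  have q_strict: "?h q < ?h j" if "q < j" "j < ?n" for j
  proof (rule ccontr)
    assume "\<not> ?h q < ?h j"
    then have "j \<le> q"
      using that order_trans[OF _ q(2)] by (intro q_last) auto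
    then show False
      using that by simp
  qed
  have steps: "step xs i = 1 \<and> xs ! i < xs ! (i + 1) \<or> step xs i = - 1 \<and> xs ! (i + 1) < xs ! i"
    if "i + 1 < ?n" for i
    using that assms(1) nth_eq_iff_index_eq[of xs i "i + 1"] by (auto simp: step_def)
  have ballot: "is_ballot (drop i xs) \<longleftrightarrow> (\<forall>j. i \<le> j \<and> j < ?n \<longrightarrow> ?h i \<le> ?h j)" if "i < ?n" for i
    using that by (rule is_ballot_drop_iff)
  have coballot: "is_coballot (take (Suc i) xs) \<longleftrightarrow> (\<forall>j\<le>i. ?h i \<le> ?h j)" if "i < ?n" for i
    using that is_coballot_take_iff[of "Suc i" xs] by (simp add: less_Suc_eq_le)
  have zero: "?f i = 0" if i: "i \<le> ?n" "i \<noteq> p" "i \<noteq> Suc q" for i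
  proof (rule ccontr)
    assume "?f i \<noteq> 0"
    then have b: "is_ballot (drop i xs)" and c: "take i xs \<noteq> [] \<Longrightarrow> is_coballot (take i xs)"
      by (auto simp: wt_ballot_def wt_coballot_def split: if_splits)
    have b': "?h i \<le> ?h j" if "i < ?n" "i \<le> j" "j < ?n" for j
      using b ballot that by blast
    have c': "?h (i - 1) \<le> ?h j" if "0 < i" "j < i" for j
      using c coballot[of "i - 1"] that i(1) assms by (auto simp: less_Suc_eq_le)
    consider "i = 0" | "i = ?n" | k where "i = Suc k" "Suc k < ?n"
      using i(1) by (cases i) (auto simp: le_less)
    then show False
    proof cases
      case 1
      then show False
        using p_first[of 0] b' n i by simp
    next
      case 2
      then have "?n - 1 \<le> q"
        using c' n by (intro q_last) auto
      then show False
        using 2 q(1) i(3) by simp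
    next
      case 3
      \<comment> \<open>Both conditions together make the lower of the letters \<open>k\<close> and
        \<open>i\<close> beside the cut a global minimum.\<close>
      have all: "?h (i - 1) \<le> ?h j \<or> ?h i \<le> ?h j" if "j < ?n" for j
        using b'[of j] c'[of j] 3 that by (cases "j < i") auto
      from steps[of k] 3 have "?h i = ?h k + 1 \<or> ?h i = ?h k - 1"
        by (auto simp: height_Suc)
      then show False
      proof
        \<comment> \<open>Letter \<open>k\<close> is a minimum but not the last one, so letter
          \<open>q\<close> lies in the suffix, where heights are at least
          \<open>?h i\<close>.\<close>
        assume up: "?h i = ?h k + 1"
        have "k \<le> q"
          using all up 3 by (intro q_last) force+
        then have "k < q"
          using 3 i(3) by simp
        then have "?h i \<le> ?h q"
          using b'[of q] 3 q by simp
        moreover have "?h q \<le> ?h k"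
          using q(2)[of k] 3 by simp
        ultimately show False
          using up by simp
      next
        \<comment> \<open>Letter \<open>i\<close> is a minimum but not the first one, so letter
          \<open>p\<close> lies in the prefix, where heights are at least
          \<open>?h k\<close>.\<close>
        assume down: "?h i = ?h k - 1"
        have "p \<le> i"
          using all down 3 by (intro p_first) force+
        then have "p \<le> k"
          using 3 i(2) by simp
        then have "?h k \<le> ?h p"
          using c'[of p] 3 by simp
        moreover have "?h p \<le> ?h i"
          using p(2)[of i] 3 by simp
        ultimately show False
          using down by simp
      qed
    qed
  qed
  \<comment> \<open>A proper cut here removes a descent, restored by the t in
    \<open>wt_coballot\<close>; for p = 0 the prefix is empty and carries no t.\<close>
  have fp: "?f p = wt xs"
  proof (cases p)
    case 0
    then have "is_ballot xs"
      using ballot[of 0] p n by simp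
    then show ?thesis
      using 0 by (simp add: wt_coballot_def wt_ballot_def)
  next
    case (Suc k)
    have c: "is_coballot (take p xs)"
    proof -
      \<comment> \<open>Heights before \<open>p\<close> exceed \<open>?h p\<close>, so by
        integrality they are at least \<open>?h p + 1\<close>, which is \<open>?h k\<close>.\<close>
      have "?h k \<le> ?h j" if "j < k" for j
        using p_strict[of j] p_strict[of k] steps[of k] Suc p(1) that by (auto simp: height_Suc)
      then show ?thesis
        using coballot[of k] Suc p(1) by (auto simp: le_less)
    qed
    have b: "is_ballot (drop p xs)"
      using ballot p by blast
    have down: "step xs k = - 1" "xs ! p < xs ! k"
      using p_strict[of k] steps[of k] Suc p(1) by (auto simp: height_Suc)
    have last: "last (take p xs) = xs ! k" and hd: "hd (drop p xs) = xs ! p"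
      using p(1) Suc by (simp_all add: take_Suc_conv_app_nth hd_drop_conv_nth)
    have "wt (take p xs @ drop p xs) = tvar * (wt (take p xs) * wt (drop p xs))"
    proof (subst wt_append)
      assume "length (take p xs) \<ge> 2"
      then obtain m where m: "k = Suc m"
        using Suc by (cases k) auto
      \<comment> \<open>An ascent into \<open>k\<close> would start at height \<open>?h p\<close>,
        before the first minimum.\<close>
      have "\<not> xs ! m < xs ! k"
        using p_strict[of m] steps[of m] down Suc p(1) m by (auto simp: height_Suc)
      then show "\<not> take p xs ! (length (take p xs) - 2) < last (take p xs)"
        using Suc m p(1) last by simp
    qed (use p(1) Suc down last hd assms in auto)
    then show ?thesis
      using b c Suc assms by (simp add: wt_ballot_def wt_coballot_def mult.assoc)
  qed
  \<comment> \<open>This cut removes at most an ascent, so the t in \<open>wt_coballot\<close>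
    survives.\<close>
  have fq: "?f (Suc q) = tvar * wt xs"
  proof (cases "Suc q = ?n")
    case True
    then have "is_coballot xs"
      using coballot[of q] q by simp
    moreover have "is_ballot []"
      by (simp add: is_ballot_def asc_des_Nil)
    ultimately show ?thesis
      using True assms by (simp add: wt_coballot_def wt_ballot_def)
  next
    case False
    then have Sq: "Suc q < ?n"
      using q(1) by simp
    have c: "is_coballot (take (Suc q) xs)"
      using coballot[of q] q by simp
    have up: "step xs q = 1" "xs ! q < xs ! Suc q"
      using q_strict[of "Suc q"] steps[of q] Sq by (auto simp: height_Suc)
    have b: "is_ballot (drop (Suc q) xs)"
    proof -
      have "?h (Suc q) \<le> ?h j" if "Suc q \<le> j" "j < ?n" for j
        using q_strict[of j] up that by (simp add: height_Suc)
      then show ?thesis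
        using ballot[OF Sq] by blast
    qed
    have last: "last (take (Suc q) xs) = xs ! q" and hd: "hd (drop (Suc q) xs) = xs ! Suc q"
      using Sq by (simp_all add: take_Suc_conv_app_nth hd_drop_conv_nth)
    have "wt (take (Suc q) xs @ drop (Suc q) xs) = 1 * (wt (take (Suc q) xs) * wt (drop (Suc q) xs))"
    proof (subst wt_append)
      assume "length (drop (Suc q) xs) \<ge> 2"
      then have "Suc (Suc q) < ?n"
        unfolding length_drop by linarith
      \<comment> \<open>A descent from \<open>Suc q\<close> would return to height
        \<open>?h q\<close> after the last minimum.\<close>
      then have "\<not> xs ! Suc (Suc q) < xs ! Suc q"
        using q_strict[of "Suc (Suc q)"] steps[of "Suc q"] up by (auto simp: height_Suc)
      then show "\<not> drop (Suc q) xs ! 1 < hd (drop (Suc q) xs)"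
        using Sq hd by simp
    qed (use Sq up last hd assms in auto)
    then show ?thesis
      using b c assms by (simp add: wt_ballot_def wt_coballot_def mult.assoc)
  qed
  have "(\<Sum>i\<le>?n. ?f i) = (\<Sum>i\<in>{p, Suc q}. ?f i)"
    using p(1) q(1) zero by (intro sum.mono_neutral_right) auto
  also have "\<dots> = ?f p + ?f (Suc q)"
    using \<open>p \<le> q\<close> by simp
  also have "\<dots> = (1 + tvar) * wt xs"
    unfolding fp fq by (simp add: algebra_simps)
  finally show ?thesis .
qed

lemma egf_factorisation: "1 + fps_const (1 + tvar) * egf wt1 = egf wt_coballot * egf wt_ballot"
proof -
  have "egf wt_coballot * egf wt_ballot
      = egf (\<lambda>\<pi>. \<Sum>i\<le>length \<pi>. wt_coballot (take i \<pi>) * wt_ballot (drop i \<pi>))"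
    by (rule egf_mult) (rule relabel_invariant_weights)+
  \<comment> \<open>The empty permutation has a single cut, of weight 1.\<close>
  also have "\<dots> = egf (\<lambda>\<pi>. of_bool (\<pi> = []) + (1 + tvar) * wt1 \<pi>)"
  proof (rule egf_cong)
    fix \<pi> :: "nat list"
    assume "distinct \<pi>"
    then show "(\<Sum>i\<le>length \<pi>. wt_coballot (take i \<pi>) * wt_ballot (drop i \<pi>))
        = of_bool (\<pi> = []) + (1 + tvar) * wt1 \<pi>"
      by (cases "\<pi> = []")
        (simp_all add: wt_splits wt1_def, simp add: wt_coballot_def wt_ballot_def is_ballot_def asc_des_Nil)
  qed
  also have "\<dots> = 1 + fps_const (1 + tvar) * egf wt1"
    by (simp only: egf_add egf_const_mult egf_Nil)
  finally show ?thesis ..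
qed

section \<open>Identification of the series and their supports\<close>

lemma B_pk_des_eq: "B_pk_des = egf wt_ballot"
proof (rule fps_ext)
  fix n
  have "ballot_perms n = {\<pi> \<in> permutations_of_set {1..n}. is_ballot \<pi>}"
    by (auto simp: ballot_perms_def is_perm_def permutations_of_set_def)
  moreover have "sum wt {\<pi> \<in> permutations_of_set {1..n}. is_ballot \<pi>}
      = sum wt_ballot (permutations_of_set {1..n})"
    by (simp add: sum.inter_filter wt_ballot_def of_bool_def if_distrib[of "\<lambda>x. x * _"] cong: if_cong)
  ultimately show "B_pk_des $ n = egf wt_ballot $ n"
    by (simp add: B_pk_des_def egf_nth wt_def)
qed

lemma egf_wt1: "egf wt1 = G_ser"
proof (rule riccati_unique)
  show "fps_deriv (egf wt1) = fps_const 1 + fps_const (1 + tvar) * egf wt1 + fps_const (yvar * tvar) * egf wt1 ^ 2"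
    by (simp add: egf_wt1_riccati del: fps_const_mult fps_const_add)
  show "fps_deriv G_ser = fps_const 1 + fps_const (1 + tvar) * G_ser + fps_const (yvar * tvar) * G_ser ^ 2"
    by (simp add: G_ser_riccati del: fps_const_mult fps_const_add)
  show "egf wt1 $ 0 = G_ser $ 0"
    by (simp add: egf_nth wt1_def G_ser_def w_ser_eq)
qed

lemma wt_nth_nonzero: "wt \<pi> $$ d \<noteq> 0 \<Longrightarrow> d = int (des \<pi>)"
proof -
  assume "wt \<pi> $$ d \<noteq> 0"
  moreover have "wt \<pi> = fls_const (fls_X ^ pk \<pi>) * fls_X ^ des \<pi>"
    by (simp add: wt_def yvar_def tvar_def fls_const_power)
  ultimately show ?thesis
    by (auto split: if_splits)
qed

lemma supported_egf:
  fixes f :: "nat list \<Rightarrow> coeff"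
  assumes "f [] = 1"
    and "\<And>\<pi> d. distinct \<pi> \<Longrightarrow> \<pi> \<noteq> [] \<Longrightarrow> f \<pi> $$ d \<noteq> 0 \<Longrightarrow> R (length \<pi>) d"
  shows "supported R (egf f - 1)"
  unfolding supported_def
proof (intro allI impI)
  fix n d
  assume nz: "(egf f - 1) $ n $$ d \<noteq> 0"
  show "R n d"
  proof (cases "n = 0")
    case True
    then show ?thesis
      using nz assms(1) by (simp add: egf_nth)
  next
    case False
    have "egf f $ n = fls_const (1 / fact n) * (\<Sum>\<pi>\<in>permutations_of_set {1..n}. f \<pi>)"
    proof -
      \<comment> \<open>The factorial is constant in t, so dividing by it keeps the exponents of
        t.\<close>
      have "fact n = fls_const (fact n :: real fls)"
        using fls_of_nat[where 'a = "real fls", of "fact n"] by simp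
      then show ?thesis
        by (simp add: egf_nth divide_inverse fls_inverse_const)
    qed
    then have "(\<Sum>\<pi>\<in>permutations_of_set {1..n}. f \<pi> $$ d) \<noteq> 0"
      using nz False by (auto simp: fls_sum_nth)
    then obtain \<pi> where \<pi>: "\<pi> \<in> permutations_of_set {1..n}" "f \<pi> $$ d \<noteq> 0"
      by (meson sum.neutral)
    moreover from this have "length \<pi> = n"
      by (simp add: length_finite_permutations_of_set)
    ultimately show ?thesis
      using assms(2)[of \<pi> d] False by (auto simp: permutations_of_set_def)
  qed
qed

text \<open>The whole permutation is one of its prefixes, so des \<le> asc = n - 1 - des.\<close>

lemma supported_ballot: "supported low (egf wt_ballot - 1)"
proof (rule supported_egf)
  show "wt_ballot [] = 1"
    by (simp add: wt_ballot_def is_ballot_def asc_des_Nil)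
  fix \<pi> d assume \<pi>: "distinct \<pi>" "\<pi> \<noteq> []" and nz: "wt_ballot \<pi> $$ d \<noteq> 0"
  then have "is_ballot \<pi>" "d = int (des \<pi>)"
    by (auto simp: wt_ballot_def wt_nth_nonzero of_bool_def split: if_splits)
  moreover from this have "des \<pi> \<le> asc \<pi>"
    unfolding is_ballot_def by (metis order_refl take_all)
  ultimately show "low (length \<pi>) d"
    using asc_des_distinct[OF \<pi>] by linarith
qed

text \<open>Here d = des + 1, while asc \<le> des gives n = asc + des + 1 \<le> 2 des + 1.\<close>

lemma supported_coballot: "supported high (egf wt_coballot - 1)"
proof (rule supported_egf)
  show "wt_coballot [] = 1"
    by (simp add: wt_coballot_def)
  fix \<pi> d assume \<pi>: "distinct \<pi>" "\<pi> \<noteq> []" and nz: "wt_coballot \<pi> $$ d \<noteq> 0"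
  then have "is_coballot \<pi>" "(tvar * wt \<pi>) $$ d \<noteq> 0"
    by (auto simp: wt_coballot_def of_bool_def split: if_splits)
  moreover from this have "d - 1 = int (des \<pi>)"
    by (intro wt_nth_nonzero) (simp add: tvar_def fls_X_times_conv_shift)
  moreover have "asc \<pi> \<le> des \<pi>"
    using \<open>is_coballot \<pi>\<close> unfolding is_coballot_def by (metis drop0 le0)
  ultimately show "high (length \<pi>) d"
    using asc_des_distinct[OF \<pi>] by linarith
qed

theorem theorem3p5:
  shows "B_pk_des = fexp (Dtx (fln1p F_ser))"
proof -
  have "fexp (Dtx (fln1p F_ser)) = egf wt_ballot"
  proof (rule exp_Dtx_ln)
    show "1 + F_ser = egf wt_coballot * egf wt_ballot"
      using egf_factorisation by (simp add: F_ser_eq egf_wt1)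
    show "egf wt_ballot $ 0 = 1" "egf wt_coballot $ 0 = 1"
      by (simp_all add: egf_nth wt_ballot_def wt_coballot_def is_ballot_def asc_des_Nil)
  qed (rule supported_ballot supported_coballot)+
  then show ?thesis
    by (simp add: B_pk_des_eq)
qed

end
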